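(* Let $n\in\mathbb{N}$. Then $$R_{(1,11)}(n)=12\sigma(n)-36\sigma\bigl(\tfrac n3\bigr)+12\sigma\bigl(\tfrac n{11}\bigr)-36\sigma\bigl(\tfrac n{33}\bigr)+144\,W_{(1,11)}(n)+1296\,W_{(1,11)}\bigl(\tfrac n3\bigr)-432\bigl(W_{(3,11)}(n)+W_{(1,33)}(n)\bigr).$$
   Context: $\mathbb{N}$ is the set of positive integers, $\mathbb{N}_0=\mathbb{N}\cup\{0\}$. $\sigma(n)=\sum_{0<d\mid n}d$ for $n\in\mathbb{N}$ and $\sigma(m)=0$ for $m\notin\mathbb{N}$. $W_{(r,s)}(n)=\sum_{(l,m)\in\mathbb{N}_0^2,\ rl+sm=n}\sigma(l)\sigma(m)$, which is $0$ if $n$ is not an integer. $R_{(c,d)}(n)$ is the number of $(x_1,\dots,x_8)\in\mathbb{Z}^8$ with $n=c(x_1^2+x_1x_2+x_2^2+x_3^2+x_3x_4+x_4^2)+d(x_5^2+x_5x_6+x_6^2+x_7^2+x_7x_8+x_8^2)$. *)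

theory Defs
  imports Complex_Main
begin

text \<open>
  The arguments of \<^emph>\<open>sigma\<close> and \<^emph>\<open>W\<close> are rational, so that \<open>n / 3\<close> and the like denote
  exact quotients; both functions vanish when the argument is not an integer.
\<close>

definition sigma :: "rat \<Rightarrow> int" where
  "sigma q = (if q \<in> \<nat> \<and> q > 0 then (\<Sum>d | d dvd nat \<lfloor>q\<rfloor>. int d) else 0)"

definition W :: "nat \<Rightarrow> nat \<Rightarrow> rat \<Rightarrow> int" where
  "W r s q = (\<Sum>(l, m) | (of_nat (r * l + s * m) :: rat) = q.
                sigma (of_nat l) * sigma (of_nat m))"

definition reps :: "nat \<Rightarrow> nat \<Rightarrow> nat \<Rightarrow>
    (int \<times> int \<times> int \<times> int \<times> int \<times> int \<times> int \<times> int) set" where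
  "reps c d n = {(x1, x2, x3, x4, x5, x6, x7, x8).
      int n = int c * (x1^2 + x1*x2 + x2^2 + x3^2 + x3*x4 + x4^2)
            + int d * (x5^2 + x5*x6 + x6^2 + x7^2 + x7*x8 + x8^2)}"

definition R :: "nat \<Rightarrow> nat \<Rightarrow> nat \<Rightarrow> nat" where
  "R c d n = card (reps c d n)"

lemma sigma_of_nat: "n > 0 \<Longrightarrow> sigma (of_nat n) = (\<Sum>d | d dvd n. int d)"
  by (simp add: sigma_def)

lemma sigma_0: "sigma 0 = 0"
  by (simp add: sigma_def)

text \<open>
  For positive coefficients the sum in \<^emph>\<open>W\<close> and the set counted by \<^emph>\<open>R\<close> are finite, so the
  conventions of \<^term>\<open>sum\<close> and \<^term>\<open>card\<close> for infinite sets play no role.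
\<close>

lemma finite_W_index:
  assumes "r > 0" "s > 0"
  shows "finite {(l, m). (of_nat (r * l + s * m) :: rat) = q}"
proof -
  have "l \<le> nat \<lfloor>q\<rfloor> \<and> m \<le> nat \<lfloor>q\<rfloor>" if "(of_nat (r * l + s * m) :: rat) = q" for l m
  proof -
    have "nat \<lfloor>q\<rfloor> = r * l + s * m"
      by (metis floor_of_nat nat_int that)
    moreover have "l \<le> r * l" "m \<le> s * m" using assms by auto
    ultimately show ?thesis by linarith
  qed
  then have "{(l, m). (of_nat (r * l + s * m) :: rat) = q} \<subseteq> {..nat \<lfloor>q\<rfloor>} \<times> {..nat \<lfloor>q\<rfloor>}"
    by blast
  then show ?thesis by (rule finite_subset) simp
qed

lemma binary_form_bound:
  fixes x y :: int
  shows "0 \<le> x^2 + x*y + y^2"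
    and "x^2 + x*y + y^2 \<le> N \<Longrightarrow> \<bar>x\<bar> \<le> 2 * N \<and> \<bar>y\<bar> \<le> 2 * N"
proof -
  define q where "q = x^2 + x*y + y^2"
  define z where "z = (x + y)^2"
  have e: "2 * q = x^2 + y^2 + z"
    by (simp add: q_def z_def power2_eq_square algebra_simps)
  have p: "0 \<le> x^2" "0 \<le> y^2" "0 \<le> z" by (simp_all add: z_def)
  have a: "\<bar>t\<bar> \<le> t^2" for t :: int
  proof (cases "t = 0")
    case False
    then have "\<bar>t\<bar> * 1 \<le> \<bar>t\<bar> * \<bar>t\<bar>" by (intro mult_left_mono) auto
    then show ?thesis by (simp add: power2_eq_square flip: abs_mult)
  qed simp
  show "0 \<le> x^2 + x*y + y^2" using e p unfolding q_def[symmetric] by linarith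
  show "\<bar>x\<bar> \<le> 2 * N \<and> \<bar>y\<bar> \<le> 2 * N" if "x^2 + x*y + y^2 \<le> N"
    using e p a[of x] a[of y] that unfolding q_def[symmetric] by linarith
qed

lemma finite_reps:
  assumes "c > 0" "d > 0"
  shows "finite (reps c d n)"
proof -
  let ?I = "{- (2 * int n)..2 * int n}"
  define f where "f x y = x^2 + x*y + y^2" for x y :: int
  have box: "{x1, x2, x3, x4, x5, x6, x7, x8} \<subseteq> ?I"
    if "(x1, x2, x3, x4, x5, x6, x7, x8) \<in> reps c d n" for x1 x2 x3 x4 x5 x6 x7 x8
  proof -
    have nn: "0 \<le> f x y" for x y
      unfolding f_def by (rule binary_form_bound)
    have in_I: "x \<in> ?I \<and> y \<in> ?I" if "f x y \<le> int n" for x y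
      using binary_form_bound(2)[of x y "int n"] that by (auto simp: f_def)
    define P where "P = f x1 x2 + f x3 x4"
    define Q where "Q = f x5 x6 + f x7 x8"
    have eq: "int n = int c * P + int d * Q"
      using that unfolding reps_def P_def Q_def f_def
      by (simp only: mem_Collect_eq case_prod_conv add.assoc)
    have PQ: "0 \<le> P" "0 \<le> Q"
      using nn by (auto simp: P_def Q_def)
    have le: "t \<le> int k * t" if "0 \<le> t" "k > 0" for t :: int and k :: nat
      using mult_right_mono[of 1 "int k" t] that by simp
    have "P \<le> int n" "Q \<le> int n"
      using eq PQ le[OF PQ(1) assms(1)] le[OF PQ(2) assms(2)] by linarith+
    then have "f x1 x2 \<le> int n" "f x3 x4 \<le> int n" "f x5 x6 \<le> int n" "f x7 x8 \<le> int n"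
      using nn[of x1 x2] nn[of x3 x4] nn[of x5 x6] nn[of x7 x8]
      unfolding P_def Q_def by linarith+
    from this[THEN in_I] show ?thesis by blast
  qed
  have "reps c d n \<subseteq> ?I \<times> ?I \<times> ?I \<times> ?I \<times> ?I \<times> ?I \<times> ?I \<times> ?I"
  proof
    fix t assume t: "t \<in> reps c d n"
    obtain x1 x2 x3 x4 x5 x6 x7 x8 where tx: "t = (x1, x2, x3, x4, x5, x6, x7, x8)"
      by (metis surj_pair)
    show "t \<in> ?I \<times> ?I \<times> ?I \<times> ?I \<times> ?I \<times> ?I \<times> ?I \<times> ?I"
      using box[OF t[unfolded tx]]
      unfolding tx mem_Times_iff fst_conv snd_conv insert_subset by (elim conjE, intro conjI)
  qed
  then show ?thesis by (rule finite_subset) simp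
qed

end

theory Submission
  imports Defs "HOL-Number_Theory.Residue_Primitive_Roots"
begin

text \<open>
  The octonary form is the sum of a quaternary form \<open>Q\<close> and of \<open>11 Q\<close>, where \<open>Q\<close> is the sum of two
  copies of \<open>x\<^sup>2 + x y + y\<^sup>2\<close>. If \<open>Q\<close> represents every \<open>n > 0\<close> exactly
  \<open>A(n) = 12 \<sigma>(n) - 36 \<sigma>(n / 3)\<close> times, and 0 once, then \<open>R\<close> is the convolution of
  \<open>[l = 0] + A(l)\<close> with \<open>[m = 0] + A(m)\<close> over \<open>l + 11 m = n\<close>. The terms with \<open>l = 0\<close> or \<open>m = 0\<close>
  give the values of \<open>\<sigma>\<close>, and the products \<open>A(l) A(m)\<close> expand into the sums \<open>W\<close>, where
  \<open>W\<close> with parameters 3 and 33 at \<open>n\<close> equals \<open>W\<close> with parameters 1 and 11 at \<open>n / 3\<close>.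

  The formula for \<open>Q\<close> rests on two facts. The first (\<open>lorenz_theorem\<close>) is that
  \<open>x\<^sup>2 + x y + y\<^sup>2\<close> represents \<open>n > 0\<close> exactly \<open>6 \<Sum> \<chi>(d)\<close> times, with \<open>d\<close> running over the divisors
  of \<open>n\<close> and \<open>\<chi>\<close> the nonprincipal character modulo 3. This form is the norm of the Eisenstein
  integers, and instead of unique factorization the proof uses the Hecke relation
  \<open>r(p n) = (1 + \<chi>(p)) r(n) - \<chi>(p) r(n / p)\<close> for primes \<open>p\<close> (\<open>hecke_relation\<close>). It
  follows from the way elements of norm divisible by \<open>p\<close> are divisible by primes of norm \<open>p\<close>; the
  divisor sum satisfies it too, and together with \<open>r(1) = 6\<close> it determines \<open>r\<close>.

  The second (\<open>liouville_identity\<close>) evaluates \<open>\<Sum> (f(a - b) - f(a + b))\<close> over all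
  \<open>a x + b y = n\<close> in positive integers, for even \<open>f\<close>, as a sum over the divisors of \<open>n\<close>. Its
  proof only moves terms by the substitution \<open>(a + b) x + b y = a x + b (x + y)\<close>. When \<open>f\<close> is the
  indicator of the multiples of 3, the summand is \<open>\<chi>(a) \<chi>(b)\<close>, which is what squaring the generating
  function of \<open>\<Sum> \<chi>(d)\<close> requires.
\<close>

section \<open>The norm form of the Eisenstein integers\<close>

text \<open>
  The norm of \<open>x + y\<zeta>\<close> in the ring of Eisenstein integers, where \<open>\<zeta>\<close> is a primitive sixth root of
  unity. The conjugate of \<open>x + y\<zeta>\<close> is \<open>(x + y) - y\<zeta>\<close>.
\<close>

definition eis_norm :: "int \<Rightarrow> int \<Rightarrow> int" where
  "eis_norm x y = x^2 + x*y + y^2"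

text \<open>
  The nonprincipal Dirichlet character modulo 3.
\<close>

definition chi3 :: "nat \<Rightarrow> int" where
  "chi3 d = (if d mod 3 = 1 then 1 else if d mod 3 = 2 then -1 else 0)"

text \<open>
  Multiplication by \<open>a + b\<zeta>\<close> in coordinates, using \<open>\<zeta>\<^sup>2 = \<zeta> - 1\<close>.
\<close>

definition eis_times :: "int \<Rightarrow> int \<Rightarrow> int \<times> int \<Rightarrow> int \<times> int" where
  "eis_times a b = (\<lambda>(x, y). (x*a - y*b, x*b + y*a + y*b))"

definition of_norm :: "int \<Rightarrow> (int \<times> int) set" where
  "of_norm n = {(x, y). eis_norm x y = n}"

text \<open>
  Division by \<open>p\<close> is kept on the left so that the set stands for the elements of norm \<open>n / p\<close>
  also when \<open>p\<close> does not divide \<open>n\<close>; it is then empty.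
\<close>

definition of_norm_over :: "int \<Rightarrow> int \<Rightarrow> (int \<times> int) set" where
  "of_norm_over p n = {(x, y). p * eis_norm x y = n}"

lemma eis_norm_nonneg: "0 \<le> eis_norm x y"
  unfolding eis_norm_def by (rule binary_form_bound)

lemma eis_norm_eq_0_iff: "eis_norm x y = 0 \<longleftrightarrow> x = 0 \<and> y = 0"
  using binary_form_bound(2)[of x y 0] by (auto simp: eis_norm_def)

lemma eis_norm_mult: "eis_norm (x*a - y*b) (x*b + y*a + y*b) = eis_norm a b * eis_norm x y"
  by (simp add: eis_norm_def power2_eq_square algebra_simps)

lemma finite_of_norm: "finite (of_norm n)"
proof (rule finite_subset)
  show "of_norm n \<subseteq> {-(2*n)..2*n} \<times> {-(2*n)..2*n}"
    using binary_form_bound(2)[of _ _ n] by (fastforce simp: of_norm_def eis_norm_def abs_le_iff)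
qed simp

text \<open>
  The two divisibility conditions say that \<open>p = N(\<pi>)\<close> divides both coordinates of
  \<open>(u + v\<zeta>) \<pi>'\<close>, where \<open>\<pi>'\<close> is the conjugate of \<open>\<pi> = a + b\<zeta>\<close>; since \<open>\<pi> \<pi>' = p\<close>, this is divisibility
  of \<open>u + v\<zeta>\<close> by \<open>\<pi>\<close>, and the inverse of multiplication by \<open>\<pi>\<close> is multiplication by \<open>\<pi>' / p\<close>.
\<close>

lemma bij_eis_times:
  assumes p: "eis_norm a b = p" "p > 0"
  shows "bij_betw (eis_times a b) (of_norm n) {(u, v) \<in> of_norm (p*n). p dvd u*(a+b) + v*b \<and> p dvd v*a - u*b}"
proof (rule bij_betw_byWitness[where f' = "\<lambda>(u, v). ((u*(a+b) + v*b) div p, (v*a - u*b) div p)"])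
  have e: "p = a*a + a*b + b*b" using p(1) by (simp add: eis_norm_def power2_eq_square)
  have r: "(x*a - y*b)*(a+b) + (x*b + y*a + y*b)*b = p*x"
    "(x*b + y*a + y*b)*a - (x*a - y*b)*b = p*y" for x y
    by (simp_all add: e algebra_simps)
  show "\<forall>z\<in>of_norm n. (\<lambda>(u, v). ((u*(a+b) + v*b) div p, (v*a - u*b) div p)) (eis_times a b z) = z"
    using p(2) by (auto simp: eis_times_def r)
  show "eis_times a b ` of_norm n \<subseteq> {(u, v) \<in> of_norm (p*n). p dvd u*(a+b) + v*b \<and> p dvd v*a - u*b}"
    by (auto simp: eis_times_def of_norm_def eis_norm_mult p r)
  have inv: "x*a - y*b = u \<and> x*b + y*a + y*b = v"
    if "u*(a+b) + v*b = p*x" "v*a - u*b = p*y" for u v x y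
  proof -
    have "p * (x*a - y*b) = (p*x)*a - (p*y)*b" "p * (x*b + y*a + y*b) = (p*x)*b + (p*y)*(a+b)"
      by (simp_all add: algebra_simps)
    hence "p * (x*a - y*b) = p * u" "p * (x*b + y*a + y*b) = p * v"
      unfolding that[symmetric] by (simp_all add: e algebra_simps)
    thus ?thesis using p(2) by auto
  qed
  show "\<forall>z\<in>{(u, v) \<in> of_norm (p*n). p dvd u*(a+b) + v*b \<and> p dvd v*a - u*b}.
      eis_times a b ((\<lambda>(u, v). ((u*(a+b) + v*b) div p, (v*a - u*b) div p)) z) = z"
    using p(2) by (auto simp: eis_times_def inv)
  show "(\<lambda>(u, v). ((u*(a+b) + v*b) div p, (v*a - u*b) div p)) `
      {(u, v) \<in> of_norm (p*n). p dvd u*(a+b) + v*b \<and> p dvd v*a - u*b} \<subseteq> of_norm n"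
  proof clarsimp
    fix u v assume uv: "(u, v) \<in> of_norm (p*n)" "p dvd u*(a+b) + v*b" "p dvd v*a - u*b"
    then obtain x y where xy: "u*(a+b) + v*b = p*x" "v*a - u*b = p*y"
      by (auto simp: dvd_def)
    have "p * eis_norm x y = p * n"
      using eis_norm_mult[of x a y b] inv[OF xy] uv(1) p(1) by (simp add: of_norm_def)
    thus "((u*(a+b) + v*b) div p, (v*a - u*b) div p) \<in> of_norm n"
      using xy p(2) by (simp add: of_norm_def)
  qed
qed

lemma eis_norm_dvd_parts:
  assumes "prime p" "p dvd eis_norm s t" "p dvd t"
  shows "p dvd s"
proof -
  have "s^2 = eis_norm s t - t * (s + t)" by (simp add: eis_norm_def algebra_simps power2_eq_square)
  hence "p dvd s^2" using assms by (metis dvd_diff dvd_mult2)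
  thus ?thesis using assms(1) prime_dvd_power by blast
qed

lemma card_multiples:
  assumes "(p::int) > 0"
  shows "card {(u, v) \<in> of_norm (p*n). p dvd u \<and> p dvd v} = card (of_norm_over p n)"
proof -
  have s: "eis_norm (p*x) (p*y) = p * (p * eis_norm x y)" for x y
    by (simp add: eis_norm_def algebra_simps power2_eq_square)
  have inj: "inj_on (\<lambda>(x, y). (p*x, p*y)) (of_norm_over p n)"
    using assms by (auto simp: inj_on_def)
  have img: "(\<lambda>(x, y). (p*x, p*y)) ` of_norm_over p n
      = {(u, v) \<in> of_norm (p*n). p dvd u \<and> p dvd v}"
  proof (intro equalityI subsetI)
    fix z assume "z \<in> {(u, v) \<in> of_norm (p*n). p dvd u \<and> p dvd v}"
    then obtain x y where xy: "z = (p*x, p*y)" "eis_norm (p*x) (p*y) = p*n"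
      by (auto simp: of_norm_def dvd_def)
    hence "p * eis_norm x y = n" using assms s by simp
    thus "z \<in> (\<lambda>(x, y). (p*x, p*y)) ` of_norm_over p n"
      using xy(1) by (auto simp: of_norm_over_def intro!: image_eqI[of _ _ "(x, y)"])
  qed (auto simp: of_norm_def of_norm_over_def s)
  show ?thesis unfolding img[symmetric] by (rule card_image[OF inj])
qed

section \<open>Hecke relations for the number of elements of given norm\<close>

text \<open>
  Let \<open>p = \<pi> \<pi>'\<close>. Every element of norm \<open>p n\<close> is divisible by \<open>\<pi>\<close> or by \<open>\<pi>'\<close>, each kind is in
  bijection with the elements of norm \<open>n\<close>, and since \<open>\<pi>\<close> and \<open>\<pi>'\<close> are coprime for \<open>p \<noteq> 3\<close>, the
  elements of both kinds are the multiples of \<open>p\<close>. Inclusion and exclusion gives the relation.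
\<close>

lemma hecke_split:
  assumes p: "eis_norm a b = p" "prime p" "p \<noteq> 3"
  shows "card (of_norm (p*n)) + card (of_norm_over p n) = 2 * card (of_norm n)"
proof -
  have p0: "p > 0" using p(2) by (simp add: prime_gt_0_int)
  have p': "eis_norm (a+b) (-b) = p"
    using p(1) by (simp add: eis_norm_def algebra_simps power2_eq_square)
  \<comment> \<open>\<open>A\<close> and \<open>B\<close> are the multiples of \<open>\<pi> = a + b\<zeta>\<close> and of \<open>\<pi>' = (a + b) - b\<zeta>\<close>.\<close>
  define A where "A = {(u, v) \<in> of_norm (p*n). p dvd u*(a+b) + v*b \<and> p dvd v*a - u*b}"
  define B where "B = {(u, v) \<in> of_norm (p*n). p dvd u*(a+b+-b) + v*(-b) \<and> p dvd v*(a+b) - u*(-b)}"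
  have cA: "card A = card (of_norm n)" and cB: "card B = card (of_norm n)"
    unfolding A_def B_def
    by (rule bij_betw_same_card[OF bij_eis_times[OF p(1) p0], symmetric],
        rule bij_betw_same_card[OF bij_eis_times[OF p' p0], symmetric])
  have un: "A \<union> B = of_norm (p*n)"
  proof (intro equalityI subsetI)
    fix z assume z: "z \<in> of_norm (p*n)"
    obtain u v where uv: "z = (u, v)" by (cases z)
    have e: "eis_norm u v = p * n" using z uv by (simp add: of_norm_def)
    \<comment> \<open>The factors are the \<open>\<zeta>\<close>-coordinates of \<open>u + v\<zeta>\<close> times \<open>\<pi>'\<close> and times \<open>\<pi>\<close>.\<close>
    have "(v*a - u*b) * (v*(a+b) - u*(-b)) = v^2 * eis_norm a b - b^2 * eis_norm u v"
      by (simp add: eis_norm_def power2_eq_square algebra_simps)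
    hence "p dvd (v*a - u*b) * (v*(a+b) - u*(-b))" using e p(1) by simp
    then consider "p dvd v*a - u*b" | "p dvd v*(a+b) - u*(-b)"
      using p(2) prime_dvd_mult_iff by blast
    thus "z \<in> A \<union> B"
    proof cases
      case 1
      have "eis_norm (u*(a+b) + v*b) (v*a - u*b) = eis_norm a b * eis_norm u v"
        by (simp add: eis_norm_def power2_eq_square algebra_simps)
      hence "p dvd eis_norm (u*(a+b) + v*b) (v*a - u*b)" using p(1) by simp
      from eis_norm_dvd_parts[OF p(2) this 1] show ?thesis using 1 z uv by (simp add: A_def)
    next
      case 2
      have "eis_norm (u*(a+b+-b) + v*(-b)) (v*(a+b) - u*(-b)) = eis_norm a b * eis_norm u v"
        by (simp add: eis_norm_def power2_eq_square algebra_simps)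
      hence "p dvd eis_norm (u*(a+b+-b) + v*(-b)) (v*(a+b) - u*(-b))" using p(1) by simp
      from eis_norm_dvd_parts[OF p(2) this 2] show ?thesis using 2 z uv by (simp add: B_def)
    qed
  qed (auto simp: A_def B_def)
  have nb: "\<not> p dvd b"
  proof
    assume b: "p dvd b"
    moreover have "p dvd a" using eis_norm_dvd_parts[OF p(2) _ b] p(1) by simp
    ultimately obtain x y where "a = p*x" "b = p*y" by (auto simp: dvd_def)
    hence "p * (p * eis_norm x y) = p * 1"
      using p(1) by (simp add: eis_norm_def algebra_simps power2_eq_square)
    hence "p * eis_norm x y = 1" using p0 by (metis mult_cancel_left less_irrefl)
    thus False using p(2) by (metis dvd_triv_left not_prime_unit)
  qed
  have "A \<inter> B = {(u, v) \<in> of_norm (p*n). p dvd u \<and> p dvd v}"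
  proof -
    have "p dvd u \<and> p dvd v" if "p dvd u*(a+b) + v*b" "p dvd v*a - u*b" "p dvd u*(a+b+-b) + v*(-b)"
      "p dvd v*(a+b) - u*(-b)" for u v
    proof -
      have "p dvd b * (u + 2*v)" "p dvd b * (2*u + v)"
        using dvd_diff[OF that(1,3)] dvd_diff[OF that(4,2)] by (simp_all add: algebra_simps)
      hence d: "p dvd u + 2*v" "p dvd 2*u + v" using nb p(2) prime_dvd_mult_iff by blast+
      have "p dvd 3 * u" using dvd_diff[OF dvd_mult[OF d(2), of 2] d(1)]
        by (simp add: algebra_simps)
      moreover have "\<not> p dvd 3"
      proof
        assume "p dvd 3"
        moreover have "prime (3::int)" by simp
        ultimately show False using p(2,3) primes_dvd_imp_eq by blast
      qed
      ultimately have u: "p dvd u" using p(2) prime_dvd_mult_iff by blast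
      have "v = (2*u + v) - 2*u" by simp
      thus ?thesis using u d(2) by (metis dvd_diff dvd_mult)
    qed
    moreover have "p dvd u*c + v*d" "p dvd v*c - u*d" if "p dvd u" "p dvd v" for u v c d
      using that by (simp_all add: dvd_add dvd_diff)
    ultimately have "(p dvd u*(a+b) + v*b \<and> p dvd v*a - u*b)
        \<and> (p dvd u*(a+b+-b) + v*(-b) \<and> p dvd v*(a+b) - u*(-b)) \<longleftrightarrow> p dvd u \<and> p dvd v" for u v
      by meson
    thus ?thesis unfolding A_def B_def
      by (simp only: set_eq_iff Int_iff split_paired_All mem_Collect_eq case_prod_conv) meson
  qed
  hence "card (A \<inter> B) = card (of_norm_over p n)" using card_multiples[OF p0] by simp
  moreover have "finite (A \<union> B)" unfolding un by (rule finite_of_norm)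
  hence "card A + card B = card (A \<union> B) + card (A \<inter> B)" by (intro card_Un_Int) auto
  ultimately show ?thesis unfolding un cA cB by linarith
qed

text \<open>
  The prime 3 is a unit times the square of \<open>1 + \<zeta>\<close>, and every element of norm divisible
  by 3 is a multiple of \<open>1 + \<zeta>\<close>.
\<close>

lemma hecke_ramified: "card (of_norm (3*n)) = card (of_norm n)"
proof -
  have "{(u, v) \<in> of_norm (3*n). 3 dvd u*(1+1) + v*1 \<and> 3 dvd v*1 - u*1} = of_norm (3*n)"
  proof -
    have "3 dvd u*2 + v \<and> 3 dvd v - u" if "eis_norm u v = 3*n" for u v
    proof -
      have "(v - u)^2 = 3 * (n - u*v)"
        using that by (simp add: eis_norm_def algebra_simps power2_eq_square)
      hence "3 dvd (v-u)^2" by simp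
      hence "3 dvd v - u" using prime_dvd_power[of "3::int"] by simp
      thus ?thesis by presburger
    qed
    thus ?thesis by (auto simp: of_norm_def)
  qed
  moreover have "eis_norm 1 1 = 3" by (simp add: eis_norm_def)
  ultimately show ?thesis using bij_eis_times[of 1 1 3 n] by (auto dest: bij_betw_same_card)
qed

text \<open>
  The norm divides \<open>x\<^sup>3 - y\<^sup>3\<close>, so \<open>x\<^sup>3 \<equiv> y\<^sup>3\<close>. Cubing is injective on the residues prime to
  \<open>p = 3k + 2\<close>, so if \<open>p\<close> does not divide \<open>y\<close>, already \<open>x \<equiv> y\<close>; but then the norm is congruent to
  \<open>3 y\<^sup>2\<close>, which is not divisible by \<open>p\<close>.
\<close>

lemma inert_dvd_components:
  fixes x y :: int
  assumes p: "prime p" "p mod 3 = 2" "int p dvd eis_norm x y"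
  shows "int p dvd x \<and> int p dvd y"
proof -
  have pp: "prime (int p)" using p(1) by simp
  have sym: "eis_norm x y = eis_norm y x" by (simp add: eis_norm_def algebra_simps)
  have "int p dvd y"
  proof (rule ccontr)
    assume ny: "\<not> int p dvd y"
    hence nx: "\<not> int p dvd x" using eis_norm_dvd_parts[OF pp, of y x] sym p(3) by auto
    obtain k where k: "p = 3*k + 2" using p(2) by (metis mult_div_mod_eq)
    have "x^3 - y^3 = (x - y) * eis_norm x y"
      by (simp add: eis_norm_def power3_eq_cube power2_eq_square algebra_simps)
    hence c3: "[x^3 = y^3] (mod int p)" using p(3) by (simp add: cong_iff_dvd_diff)
    have fx: "[z^(3*k+1) = 1] (mod int p)" if "\<not> int p dvd z" for z
    proof -
      define w where "w = nat (z mod int p)"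
      have w: "int w = z mod int p" using p(1) by (simp add: w_def prime_gt_0_nat)
      have "\<not> p dvd w" using that w by (metis dvd_mod_iff dvd_refl int_dvd_int_iff)
      hence "[int (w^(p-1)) = int 1] (mod int p)"
        using fermat_theorem[OF p(1)] cong_int_iff by blast
      moreover have "[int w = z] (mod int p)" by (simp add: w)
      ultimately have "[z^(p-1) = 1] (mod int p)"
        by (metis cong_pow cong_sym cong_trans of_nat_1 of_nat_power)
      thus ?thesis using k by simp
    qed
    have "[x * (x^3)^k = 1] (mod int p)" "[y * (y^3)^k = 1] (mod int p)"
      using fx[OF nx] fx[OF ny] by (simp_all add: power_mult)
    moreover have "[x * (x^3)^k = x * (y^3)^k] (mod int p)"
      by (intro cong_mult cong_pow cong_refl c3)
    ultimately have "[x * (y^3)^k = y * (y^3)^k] (mod int p)" by (metis cong_sym cong_trans)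
    moreover have "coprime ((y^3)^k) (int p)"
      using ny pp by (metis coprime_commute coprime_power_left_iff prime_imp_coprime)
    ultimately have "[x = y] (mod int p)" by (metis cong_mult_rcancel)
    hence xy: "int p dvd x - y" by (simp add: cong_iff_dvd_diff)
    have "3 * (y * y) = eis_norm x y - (x - y) * (x + 2*y)"
      by (simp add: eis_norm_def power2_eq_square algebra_simps)
    hence "int p dvd 3 * (y*y)" using xy p(3) by (metis dvd_diff dvd_mult2)
    hence "int p dvd 3" using ny pp prime_dvd_mult_iff by blast
    hence "p dvd 3" by presburger
    hence "p = 3" using p(1) primes_dvd_imp_eq[of p 3] by simp
    thus False using p(2) by simp
  qed
  thus ?thesis using eis_norm_dvd_parts[OF pp p(3)] by simp
qed

lemma hecke_inert:
  assumes p: "prime p" "p mod 3 = 2"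
  shows "card (of_norm (int p * n)) = card (of_norm_over (int p) n)"
proof -
  have "{(u, v) \<in> of_norm (int p * n). int p dvd u \<and> int p dvd v} = of_norm (int p * n)"
  proof -
    have "int p dvd u \<and> int p dvd v" if "eis_norm u v = int p * n" for u v
      by (rule inert_dvd_components[OF p]) (simp add: that)
    thus ?thesis unfolding of_norm_def by blast
  qed
  moreover have "int p > 0" using p(1) by (simp add: prime_gt_0_nat)
  ultimately show ?thesis using card_multiples[of "int p" n] by presburger
qed

text \<open>
  The power \<open>g\<^sup>k\<close> of a primitive root \<open>g\<close> modulo \<open>p = 3k + 1\<close> has order 3.
\<close>

lemma primitive_cube_root_of_unity_mod:
  fixes p :: nat
  assumes p: "prime p" "p mod 3 = 1"
  shows "\<exists>t::int. int p dvd t^2 + t + 1"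
proof -
  have "p > 1" by (rule prime_gt_1_nat[OF p(1)])
  obtain g where "residue_primroot p g"
    using prime_primitive_root_exists[OF \<open>p > 1\<close> p(1)] by blast
  hence ord: "ord p g = p - 1"
    using totient_prime[OF p(1)] unfolding residue_primroot_def by simp
  obtain k where k: "p = 3*k + 1" using p(2) by (metis mult_div_mod_eq)
  have "k > 0" using k \<open>p > 1\<close> by auto
  have ord3: "ord p g = 3*k" using ord k by simp
  have "\<not> 3*k dvd k" using \<open>k > 0\<close> by (auto dest: dvd_imp_le)
  hence n1: "\<not> [g^k = 1] (mod p)" unfolding ord_divides ord3 .
  have "[g^(3*k) = 1] (mod p)" unfolding ord_divides ord3 by simp
  define t where "t = int g ^ k"
  have "[int (g^k)^3 = int 1] (mod int p)" using \<open>[g^(3*k) = 1] (mod p)\<close>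
    by (metis cong_int_iff of_nat_power power_mult mult.commute)
  hence "int p dvd t^3 - 1" by (simp add: t_def cong_iff_dvd_diff)
  moreover have "t^3 - 1 = (t - 1) * (t^2 + t + 1)"
    by (simp add: power3_eq_cube power2_eq_square algebra_simps)
  moreover have "\<not> int p dvd t - 1"
  proof
    assume "int p dvd t - 1"
    hence "[int (g^k) = int 1] (mod int p)" by (simp add: t_def cong_iff_dvd_diff)
    thus False using n1 cong_int_iff by blast
  qed
  ultimately have "int p dvd t^2 + t + 1"
    using p(1) by (metis prime_dvd_mult_iff prime_int_nat_transfer prime_nat_int_transfer)
  thus ?thesis ..
qed

text \<open>
  Thue's argument. Let \<open>t\<^sup>2 + t + 1 \<equiv> 0\<close>. There are more than \<open>p\<close> pairs \<open>(u, v)\<close> with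
  \<open>0 \<le> u, v \<le> \<surd>p\<close>, so two of them agree in \<open>u - t v\<close> modulo \<open>p\<close>. Their difference has norm
  divisible by \<open>p\<close> and strictly between \<open>0\<close> and \<open>3p\<close>, and the norm \<open>2p\<close> is impossible because the
  prime 2 is inert: both coordinates would be even and the norm divisible by 4.
\<close>

lemma split_prime_is_norm:
  fixes p :: nat
  assumes p: "prime p" "p mod 3 = 1"
  shows "\<exists>a b. eis_norm a b = int p"
proof -
  obtain t :: int where t: "int p dvd t^2 + t + 1" using primitive_cube_root_of_unity_mod[OF p]
    by blast
  have p0: "p > 0" by (rule prime_gt_0_nat[OF p(1)])
  define k where "k = nat \<lfloor>sqrt (real p)\<rfloor>"
  have k_le: "real k \<le> sqrt p" and k_gt: "sqrt p < real k + 1"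
    unfolding k_def by (simp_all add: of_nat_nat)
  have "real (k^2) \<le> real p"
    using k_le by (metis of_nat_0_le_iff of_nat_power real_le_rsqrt real_sqrt_ge_0_iff real_sqrt_pow2 power_mono)
  moreover have "k^2 \<noteq> p"
  proof
    assume "k^2 = p"
    thus False using p(1) by (metis prime_power_iff[of k 2] one_neq_zero numeral_eq_one_iff semiring_norm(85))
  qed
  ultimately have k1: "k^2 < p" by simp
  have "sqrt p < sqrt (real ((k+1)^2))" using k_gt by simp
  hence k2: "p < (k+1)^2" by (simp only: real_sqrt_less_iff of_nat_less_iff)
  define S where "S = {0..int k} \<times> {0..int k}"
  define f where "f = (\<lambda>(u, v). (u - t*v) mod int p)"
  have "card S = (k+1)^2"
    by (simp add: S_def card_cartesian_product power2_eq_square nat_add_distrib)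
  moreover have "f ` S \<subseteq> {0..<int p}" using p0 by (auto simp: f_def)
  hence "card (f ` S) \<le> p" using card_mono[of "{0..<int p}" "f ` S"] by simp
  ultimately have "\<not> inj_on f S" using k2 card_image by fastforce
  then obtain u v u' v' where S: "(u, v) \<in> S" "(u', v') \<in> S" "(u, v) \<noteq> (u', v')" "f (u, v) = f (u', v')"
    by (auto simp: inj_on_def)
  define a b where "a = u - u'" and "b = v - v'"
  have "int p dvd (u - t*v) - (u' - t*v')" using S(4) by (simp add: f_def mod_eq_dvd_iff)
  hence d: "int p dvd a - t*b" by (simp add: a_def b_def algebra_simps)
  have "eis_norm a b = (a - t*b) * (a + t*b + b) + b^2 * (t^2 + t + 1)"
    by (simp add: eis_norm_def power2_eq_square algebra_simps)
  hence dvd: "int p dvd eis_norm a b" using d t by simp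
  have bd: "\<bar>a\<bar> \<le> int k" "\<bar>b\<bar> \<le> int k" using S(1,2) by (auto simp: S_def a_def b_def)
  have "a^2 \<le> (int k)^2" "b^2 \<le> (int k)^2" using bd by (metis abs_ge_zero power2_abs power_mono)+
  moreover have "a * b \<le> int k * int k"
    using mult_mono[OF bd] abs_ge_self[of "a * b"] by (simp add: abs_mult)
  moreover have "(int k)^2 < int p" using k1 by (metis of_nat_less_iff of_nat_power)
  ultimately have lt: "eis_norm a b < 3 * int p" by (simp add: eis_norm_def power2_eq_square)
  have "eis_norm a b > 0" using S(3) eis_norm_nonneg[of a b] eis_norm_eq_0_iff[of a b]
    by (auto simp: a_def b_def order_less_le)
  obtain c where c: "eis_norm a b = int p * c" using dvd by (auto simp: dvd_def)
  have "c > 0" using c \<open>eis_norm a b > 0\<close> p0 by (simp add: zero_less_mult_iff)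
  moreover have "c < 3" using c lt p0 by (simp add: mult.commute)
  moreover have "c \<noteq> 2"
  proof
    assume "c = 2"
    hence "int 2 dvd eis_norm a b" using c by simp
    from inert_dvd_components[OF _ _ this] obtain x y where "a = 2*x" "b = 2*y"
      by (auto simp: dvd_def)
    hence "int p = 2 * eis_norm x y"
      using c \<open>c = 2\<close> by (simp add: eis_norm_def algebra_simps power2_eq_square)
    hence "2 dvd p" by presburger
    hence "p = 2" using p(1) primes_dvd_imp_eq[of 2 p] by simp
    thus False using p(2) by simp
  qed
  ultimately have "c = 1" by simp
  thus ?thesis using c by auto
qed

section \<open>Representations by the binary form\<close>

lemma chi3_mult: "chi3 (a*b) = chi3 a * chi3 b"
proof -
  have "a mod 3 = 0 \<or> a mod 3 = 1 \<or> a mod 3 = 2" "b mod 3 = 0 \<or> b mod 3 = 1 \<or> b mod 3 = 2"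
    by presburger+
  moreover have "(a*b) mod 3 = ((a mod 3) * (b mod 3)) mod 3" by (simp add: mod_mult_eq)
  ultimately show ?thesis unfolding chi3_def by (elim disjE) simp_all
qed

text \<open>
  The factor \<open>1 + \<chi>(p)\<close> counts the primes of norm \<open>p\<close> up to units: one, two or none according as
  \<open>p\<close> ramifies, splits or is inert.
\<close>

lemma hecke_relation:
  fixes p :: nat
  assumes "prime p"
  shows "int (card (of_norm (int p * n)))
    = (1 + chi3 p) * int (card (of_norm n)) - chi3 p * int (card (of_norm_over (int p) n))"
proof -
  consider "p mod 3 = 0" | "p mod 3 = 1" | "p mod 3 = 2" by linarith
  thus ?thesis
  proof cases
    case 1
    hence "p = 3" using assms primes_dvd_imp_eq[of 3 p] by auto
    thus ?thesis using hecke_ramified[of n] by (simp add: chi3_def)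
  next
    case 2
    then obtain a b where ab: "eis_norm a b = int p" using split_prime_is_norm assms by blast
    have "int p \<noteq> 3" using 2 by auto
    have "card (of_norm (int p * n)) + card (of_norm_over (int p) n) = 2 * card (of_norm n)"
      by (rule hecke_split[OF ab _ \<open>int p \<noteq> 3\<close>]) (use assms in simp)
    thus ?thesis using 2 by (simp add: chi3_def)
  next
    case 3
    thus ?thesis using hecke_inert[OF assms 3] by (simp add: chi3_def)
  qed
qed

text \<open>
  A divisor of \<open>p n\<close> divides \<open>n\<close> or is \<open>p\<close> times a divisor of \<open>n\<close>; both happen for \<open>p d\<close> with
  \<open>p d\<close> dividing \<open>n\<close>.
\<close>

lemma sum_chi3_hecke:
  fixes p :: nat
  assumes p: "prime p" and n: "n > 0"
  shows "(\<Sum>d | d dvd p*n. chi3 d) = (1 + chi3 p) * (\<Sum>d | d dvd n. chi3 d)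
     - chi3 p * (\<Sum>d | p * d dvd n. chi3 d)"
proof -
  have p0: "p > 0" by (rule prime_gt_0_nat[OF p])
  have fin: "finite {d. d dvd n}" using n by simp
  have sub: "{d. p * d dvd n} \<subseteq> {d. d dvd n}" by (auto intro: dvd_mult_right)
  have inj: "inj_on ((*) p) D" for D using p0 by (simp add: inj_on_def)
  have un: "{d. d dvd p*n} = {d. d dvd n} \<union> (*) p ` {d. d dvd n}"
  proof (intro equalityI subsetI)
    fix d assume "d \<in> {d. d dvd p*n}"
    hence d: "d dvd p*n" by simp
    show "d \<in> {d. d dvd n} \<union> (*) p ` {d. d dvd n}"
    proof (cases "p dvd d")
      case True
      then obtain e where "d = p*e" by (auto simp: dvd_def)
      thus ?thesis using d p0 by simp
    next
      case False
      hence "coprime d p" using p by (metis coprime_commute prime_imp_coprime)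
      thus ?thesis using d by (simp add: coprime_dvd_mult_right_iff)
    qed
  qed auto
  have int: "{d. d dvd n} \<inter> (*) p ` {d. d dvd n} = (*) p ` {d. p * d dvd n}"
    using sub by auto
  have s: "(\<Sum>d\<in>(*) p ` D. chi3 d) = chi3 p * (\<Sum>d\<in>D. chi3 d)" for D
    by (simp add: sum.reindex[OF inj] chi3_mult sum_distrib_left)
  have "(\<Sum>d | d dvd p*n. chi3 d) + (\<Sum>d\<in>(*) p ` {d. p * d dvd n}. chi3 d)
     = (\<Sum>d | d dvd n. chi3 d) + (\<Sum>d\<in>(*) p ` {d. d dvd n}. chi3 d)"
    unfolding un int[symmetric] using fin by (intro sum.union_inter) auto
  thus ?thesis unfolding s by (simp add: algebra_simps)
qed

lemma card_of_norm_1: "card (of_norm 1) = 6"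
proof -
  have "of_norm 1 = {(1,0), (-1,0), (0,1), (0,-1), (1,-1), (-1,1)}"
  proof -
    have "(x, y) \<in> {(1,0), (-1,0), (0,1), (0,-1), (1,-1), (-1,1)}" if e: "eis_norm x y = 1" for x y
    proof -
      have "\<bar>x\<bar> \<le> 2 \<and> \<bar>y\<bar> \<le> 2" using binary_form_bound(2)[of x y 1] e by (simp add: eis_norm_def)
      hence "x = -2 \<or> x = -1 \<or> x = 0 \<or> x = 1 \<or> x = 2"
        "y = -2 \<or> y = -1 \<or> y = 0 \<or> y = 1 \<or> y = 2" by presburger+
      thus ?thesis using e unfolding eis_norm_def by (elim disjE) simp_all
    qed
    moreover have "eis_norm 1 0 = 1" "eis_norm (-1) 0 = 1" "eis_norm 0 1 = 1"
      "eis_norm 0 (-1) = 1" "eis_norm 1 (-1) = 1" "eis_norm (-1) 1 = 1"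
      by (simp_all add: eis_norm_def)
    ultimately show ?thesis unfolding of_norm_def by auto
  qed
  thus ?thesis by simp
qed

text \<open>
  Both sides satisfy the same Hecke relation for every prime, and they agree at 1, where the
  left side counts the six units.
\<close>

theorem lorenz_theorem:
  assumes "n > 0"
  shows "int (card (of_norm (int n))) = 6 * (\<Sum>d | d dvd n. chi3 d)"
  using assms
proof (induction n rule: less_induct)
  case (less n)
  show ?case
  proof (cases "n = 1")
    case True
    thus ?thesis by (simp add: card_of_norm_1 chi3_def)
  next
    case False
    then obtain p where p: "prime p" "p dvd n" using prime_factor_nat by blast
    then obtain m where m: "n = p * m" by (auto simp: dvd_def)
    have m0: "m > 0" using less.prems m by (cases m) auto
    have lt: "m < n" using m m0 prime_gt_1_nat[OF p(1)] by simp
    have *: "int (card (of_norm_over (int p) (int m))) = 6 * (\<Sum>d | p * d dvd m. chi3 d)"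
    proof (cases "p dvd m")
      case True
      then obtain k where k: "m = p * k" by (auto simp: dvd_def)
      have "k > 0" using m0 k by (cases k) auto
      have "k \<le> m" using k prime_gt_0_nat[OF p(1)] by simp
      hence "int (card (of_norm (int k))) = 6 * (\<Sum>d | d dvd k. chi3 d)"
        using less.IH[of k] lt \<open>k > 0\<close> by simp
      moreover have "of_norm_over (int p) (int m) = of_norm (int k)"
        using k prime_gt_0_nat[OF p(1)] by (simp add: of_norm_def of_norm_over_def)
      moreover have "{d. p * d dvd m} = {d. d dvd k}"
        using k prime_gt_0_nat[OF p(1)] by simp
      ultimately show ?thesis by simp
    next
      case False
      have "of_norm_over (int p) (int m) = {}" using False
        by (auto simp: of_norm_over_def) (metis dvd_triv_left int_dvd_int_iff)
      moreover have "{d. p * d dvd m} = {}" using False by (auto intro: dvd_mult_left)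
      ultimately show ?thesis by simp
    qed
    show ?thesis
      using hecke_relation[OF p(1), of "int m"] sum_chi3_hecke[OF p(1) m0] less.IH[OF lt m0] *
      unfolding m of_nat_mult by (simp add: algebra_simps)
  qed
qed

section \<open>Liouville's identity\<close>

text \<open>
  Sums over the ways to write \<open>n\<close> as \<open>a x + b y\<close> in positive integers. The condition is a separate
  argument because the proofs move sums between regions such as \<open>b < a\<close> and \<open>x < y\<close>.
\<close>

definition liouville_sum :: "nat \<Rightarrow> (nat \<Rightarrow> nat \<Rightarrow> nat \<Rightarrow> nat \<Rightarrow> bool) \<Rightarrow>
    (nat \<Rightarrow> nat \<Rightarrow> nat \<Rightarrow> nat \<Rightarrow> 'a) \<Rightarrow> 'a::comm_ring_1" where
  "liouville_sum n P F = (\<Sum>(a, x, b, y) |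
     0 < a \<and> 0 < x \<and> 0 < b \<and> 0 < y \<and> a*x + b*y = n \<and> P a x b y. F a x b y)"

lemma finite_liouville_index:
  "finite {(a, x, b, y). 0 < a \<and> 0 < x \<and> 0 < b \<and> 0 < y \<and> a*x + b*y = (n::nat) \<and> P a x b y}"
proof (rule finite_subset)
  have "a \<le> n \<and> x \<le> n \<and> b \<le> n \<and> y \<le> n" if "0 < a" "0 < x" "0 < b" "0 < y" "a*x + b*y = n" for a x b y
  proof -
    have "a \<le> a*x" "x \<le> a*x" "b \<le> b*y" "y \<le> b*y" using that by auto
    thus ?thesis using that(5) by linarith
  qed
  thus "{(a, x, b, y). 0 < a \<and> 0 < x \<and> 0 < b \<and> 0 < y \<and> a*x + b*y = n \<and> P a x b y}
      \<subseteq> {..n} \<times> {..n} \<times> {..n} \<times> {..n}" by auto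
qed simp

lemma liouville_sum_split:
  assumes "\<And>a x b y. P a x b y \<or> Q a x b y" "\<And>a x b y. \<not> (P a x b y \<and> Q a x b y)"
  shows "liouville_sum n (\<lambda>a x b y. True) F = liouville_sum n P F + liouville_sum n Q F"
  unfolding liouville_sum_def
  by (subst sum.union_disjoint[symmetric], (rule finite_liouville_index)+)
     (use assms in \<open>auto intro!: sum.cong\<close>)

lemma liouville_sum_trichotomy:
  fixes u v :: "nat \<Rightarrow> nat \<Rightarrow> nat \<Rightarrow> nat \<Rightarrow> nat"
  shows "liouville_sum n (\<lambda>a x b y. True) F = liouville_sum n (\<lambda>a x b y. u a x b y < v a x b y) F
    + liouville_sum n (\<lambda>a x b y. v a x b y < u a x b y) F + liouville_sum n (\<lambda>a x b y. u a x b y = v a x b y) F"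
proof -
  have "liouville_sum n (\<lambda>a x b y. u a x b y \<noteq> v a x b y) F
      = liouville_sum n (\<lambda>a x b y. u a x b y < v a x b y) F + liouville_sum n (\<lambda>a x b y. v a x b y < u a x b y) F"
    unfolding liouville_sum_def
    by (subst sum.union_disjoint[symmetric], (rule finite_liouville_index)+) (auto intro!: sum.cong)
  thus ?thesis
    using liouville_sum_split[of "\<lambda>a x b y. u a x b y \<noteq> v a x b y" "\<lambda>a x b y. u a x b y = v a x b y" n F]
      by simp
qed

lemma liouville_sum_swap: "liouville_sum n P F = liouville_sum n (\<lambda>a x b y. P b y a x) (\<lambda>a x b y. F b y a x)"
  unfolding liouville_sum_def
  by (rule sum.reindex_bij_witness[of _ "\<lambda>(a, x, b, y). (b, y, a, x)" "\<lambda>(a, x, b, y). (b, y, a, x)"])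
     (auto simp: add.commute)

text \<open>
  This is the substitution \<open>(a + b) x + b y = a x + b (x + y)\<close>.
\<close>

lemma liouville_sum_shear:
  "liouville_sum n (\<lambda>a x b y. b < a) F = liouville_sum n (\<lambda>a x b y. x < y) (\<lambda>a x b y. F (a + b) x b (y - x))"
  unfolding liouville_sum_def
proof (rule sum.reindex_bij_witness[of _ "\<lambda>(a, x, b, y). (a + b, x, b, y - x)"
      "\<lambda>(a, x, b, y). (a - b, x, b, x + y)"], goal_cases)
  case (2 z)
  obtain a x b y where z: "z = (a, x, b, y)" by (cases z)
  with 2 have "b < a" "a*x + b*y = n" "0 < y" "0 < x" "0 < b" by auto
  then obtain c where "a = b + c" "0 < c" by (metis less_imp_add_positive)
  thus ?case using z \<open>a*x + b*y = n\<close> \<open>0 < y\<close> \<open>0 < x\<close> \<open>0 < b\<close> by (simp add: algebra_simps)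
next
  case (4 z)
  obtain a x b y where z: "z = (a, x, b, y)" by (cases z)
  with 4 have "x < y" "a*x + b*y = n" "0 < a" "0 < x" "0 < b" by auto
  then obtain c where "y = x + c" "0 < c" by (metis less_imp_add_positive)
  thus ?case using z \<open>a*x + b*y = n\<close> \<open>0 < a\<close> \<open>0 < x\<close> \<open>0 < b\<close> by (simp add: algebra_simps)
qed auto

text \<open>
  The same substitution, conjugated by the exchange of \<open>(a, x)\<close> and \<open>(b, y)\<close>.
\<close>

lemma liouville_sum_shear':
  "liouville_sum n (\<lambda>a x b y. a < b) F = liouville_sum n (\<lambda>a x b y. y < x) (\<lambda>a x b y. F a (x - y) (a + b) y)"
proof -
  have "liouville_sum n (\<lambda>a x b y. a < b) F = liouville_sum n (\<lambda>a x b y. b < a) (\<lambda>a x b y. F b y a x)"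
    by (rule liouville_sum_swap)
  also have "\<dots> = liouville_sum n (\<lambda>a x b y. x < y) (\<lambda>a x b y. F b (y - x) (a + b) x)"
    by (rule liouville_sum_shear)
  also have "\<dots> = liouville_sum n (\<lambda>a x b y. y < x) (\<lambda>a x b y. F a (x - y) (b + a) y)"
    by (rule liouville_sum_swap)
  finally show ?thesis by (simp add: add.commute)
qed

lemma liouville_sum_diagonal:
  assumes "n > 0"
  shows "liouville_sum n (\<lambda>a x b y. a = b) F = (\<Sum>d | d dvd n. \<Sum>l\<in>{1..<n div d}. F d l d (n div d - l))"
proof -
  have "(\<Sum>d | d dvd n. \<Sum>l\<in>{1..<n div d}. F d l d (n div d - l))
     = (\<Sum>(d, l)\<in>(SIGMA d:{d. d dvd n}. {1..<n div d}). F d l d (n div d - l))"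
    using assms by (intro sum.Sigma) auto
  also have "\<dots> = liouville_sum n (\<lambda>a x b y. a = b) F"
    unfolding liouville_sum_def
  proof (rule sum.reindex_bij_witness[of _ "\<lambda>(a, x, b, y). (a, x)" "\<lambda>(d, l). (d, l, d, n div d - l)"], goal_cases)
    case (2 z)
    obtain d l where z: "z = (d, l)" by (cases z)
    with 2 have d: "d dvd n" "1 \<le> l" "l < n div d" by auto
    then obtain k where k: "n = d*k" by (auto simp: dvd_def)
    with assms have "0 < d" by (cases d) auto
    with k d have "l < k" by simp
    then obtain j where "k = l + j" "0 < j" by (metis less_imp_add_positive)
    thus ?case using z k \<open>0 < d\<close> d(2) by (simp add: algebra_simps)
  next
    case (3 z)
    then obtain a x y where z: "z = (a, x, a, y)" "0 < a" "0 < x" "0 < y" "n = a*(x+y)"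
      by (auto simp: algebra_simps)
    hence "n div a = x + y" by simp
    thus ?case using z by simp
  next
    case (4 z)
    then obtain a x y where z: "z = (a, x, a, y)" "0 < a" "0 < x" "0 < y" "n = a*(x+y)"
      by (auto simp: algebra_simps)
    hence "n div a = x + y" by simp
    thus ?case using z by simp
  qed auto
  finally show ?thesis ..
qed

lemma sum_divisors_flip:
  fixes f :: "nat \<Rightarrow> 'a::comm_monoid_add"
  assumes "n > (0::nat)"
  shows "(\<Sum>d | d dvd n. f (n div d)) = (\<Sum>d | d dvd n. f d)"
  using assms by (intro sum.reindex_bij_witness[of _ "(div) n" "(div) n"]) (auto elim!: dvdE)

lemma liouville_sum_diagonal':
  assumes "n > 0"
  shows "liouville_sum n (\<lambda>a x b y. x = y) F = (\<Sum>d | d dvd n. \<Sum>l\<in>{1..<d}. F l (n div d) (d - l) (n div d))"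
proof -
  have "liouville_sum n (\<lambda>a x b y. x = y) F = liouville_sum n (\<lambda>a x b y. a = b) (\<lambda>a x b y. F x a y b)"
    unfolding liouville_sum_def
    by (rule sum.reindex_bij_witness[of _ "\<lambda>(a, x, b, y). (x, a, y, b)" "\<lambda>(a, x, b, y). (x, a, y, b)"])
       (auto simp: mult.commute)
  also have "\<dots> = (\<Sum>d | d dvd n. \<Sum>l\<in>{1..<n div d}. F l d (n div d - l) d)"
    using assms by (rule liouville_sum_diagonal)
  also have "\<dots> = (\<Sum>d | d dvd n. \<Sum>l\<in>{1..<n div d}. F l (n div (n div d)) (n div d - l) (n div (n div d)))"
    using assms by (intro sum.cong refl) (auto elim!: dvdE)
  also have "\<dots> = (\<Sum>d | d dvd n. \<Sum>l\<in>{1..<d}. F l (n div d) (d - l) (n div d))"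
    by (rule sum_divisors_flip[OF assms, of "\<lambda>d. \<Sum>l\<in>{1..<d}. F l (n div d) (d - l) (n div d)"])
  finally show ?thesis .
qed

text \<open>
  The shear takes the part \<open>b < a\<close> of the sum of \<open>f(a - b)\<close> to the sum of \<open>f(a)\<close> over \<open>x < y\<close>,
  and the part \<open>x < y\<close> of the sum of \<open>f(a + b)\<close> to the sum of \<open>f(a)\<close> over \<open>b < a\<close>; the opposite parts
  follow by symmetry, as \<open>f\<close> is even. The two sums of \<open>f(a)\<close> are complementary to the ones over \<open>y < x\<close>
  and \<open>a < b\<close>, which the conjugate shear identifies, up to the diagonals. Hence only the terms with
  \<open>a = b\<close> or \<open>x = y\<close> survive, and these are divisor sums.
\<close>

theorem liouville_identity:
  fixes f :: "int \<Rightarrow> 'a::comm_ring_1"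
  assumes even: "\<And>k. f (- k) = f k" and n: "n > 0"
  shows "liouville_sum n (\<lambda>a x b y. True) (\<lambda>a x b y. f (int a - int b) - f (int a + int b))
    = (\<Sum>d | d dvd n. of_nat (n div d - 1) * (f 0 + 2 * f (int d))
        - of_nat (d - 1) * f (int d) - 2 * (\<Sum>l\<in>{1..<d}. f (int l)))"
proof -
  let ?T = "\<lambda>a x b y. True"
  let ?minus = "\<lambda>a x b y. f (int a - int b)" and ?plus = "\<lambda>a x b y. f (int a + int b)"
  let ?fst = "\<lambda>a x b y. f (int a)"
  have flip: "f (int a - int b) = f (int b - int a)" for a b
    using even[of "int a - int b"] by simp
  have minus: "liouville_sum n ?T ?minus = 2 * liouville_sum n (\<lambda>a x b y. x < y) ?fst + liouville_sum n (\<lambda>a x b y. a = b) ?minus"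
  proof -
    have "liouville_sum n (\<lambda>a x b y. b < a) ?minus = liouville_sum n (\<lambda>a x b y. x < y) ?fst"
      by (simp add: liouville_sum_shear)
    moreover have "liouville_sum n (\<lambda>a x b y. a < b) ?minus = liouville_sum n (\<lambda>a x b y. b < a) ?minus"
      by (subst liouville_sum_swap) (simp add: flip)
    ultimately show ?thesis
      using liouville_sum_trichotomy[of n ?minus "\<lambda>a x b y. a" "\<lambda>a x b y. b"] by simp
  qed
  have plus: "liouville_sum n ?T ?plus = 2 * liouville_sum n (\<lambda>a x b y. b < a) ?fst + liouville_sum n (\<lambda>a x b y. x = y) ?plus"
  proof -
    have "liouville_sum n (\<lambda>a x b y. x < y) ?plus = liouville_sum n (\<lambda>a x b y. b < a) ?fst"
      by (simp add: liouville_sum_shear)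
    moreover have "liouville_sum n (\<lambda>a x b y. y < x) ?plus = liouville_sum n (\<lambda>a x b y. x < y) ?plus"
      by (subst liouville_sum_swap) (simp add: add.commute)
    ultimately show ?thesis
      using liouville_sum_trichotomy[of n ?plus "\<lambda>a x b y. x" "\<lambda>a x b y. y"] by simp
  qed
  have "liouville_sum n (\<lambda>a x b y. a < b) ?fst = liouville_sum n (\<lambda>a x b y. y < x) ?fst"
    by (rule liouville_sum_shear')
  hence cancel: "liouville_sum n (\<lambda>a x b y. x < y) ?fst - liouville_sum n (\<lambda>a x b y. b < a) ?fst
      = liouville_sum n (\<lambda>a x b y. a = b) ?fst - liouville_sum n (\<lambda>a x b y. x = y) ?fst"
    using liouville_sum_trichotomy[of n ?fst "\<lambda>a x b y. a" "\<lambda>a x b y. b"]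
      liouville_sum_trichotomy[of n ?fst "\<lambda>a x b y. x" "\<lambda>a x b y. y"] by (simp add: algebra_simps)
  have "liouville_sum n ?T (\<lambda>a x b y. f (int a - int b) - f (int a + int b)) = liouville_sum n ?T ?minus - liouville_sum n ?T ?plus"
    unfolding liouville_sum_def by (subst sum_subtractf[symmetric]) (simp add: case_prod_unfold)
  also have "\<dots> = 2 * (liouville_sum n (\<lambda>a x b y. x < y) ?fst - liouville_sum n (\<lambda>a x b y. b < a) ?fst)
      + liouville_sum n (\<lambda>a x b y. a = b) ?minus - liouville_sum n (\<lambda>a x b y. x = y) ?plus"
    unfolding minus plus by (simp add: algebra_simps)
  also have "\<dots> = (\<Sum>d | d dvd n. 2 * (of_nat (n div d - 1) * f (int d)) - 2 * (\<Sum>l\<in>{1..<d}. f (int l))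
      + of_nat (n div d - 1) * f 0 - of_nat (d - 1) * f (int d))"
  proof -
    have "(\<Sum>l\<in>{1..<d}. f (int l + int (d - l))) = of_nat (d - 1) * f (int d)" for d
    proof -
      have "(\<Sum>l\<in>{1..<d}. f (int l + int (d - l))) = (\<Sum>l\<in>{1..<d}. f (int d))"
        by (intro sum.cong) auto
      thus ?thesis by simp
    qed
    thus ?thesis
      unfolding cancel liouville_sum_diagonal[OF n] liouville_sum_diagonal'[OF n]
      by (simp add: sum.distrib sum_subtractf sum_distrib_left algebra_simps)
  qed
  also have "\<dots> = (\<Sum>d | d dvd n. of_nat (n div d - 1) * (f 0 + 2 * f (int d))
        - of_nat (d - 1) * f (int d) - 2 * (\<Sum>l\<in>{1..<d}. f (int l)))"
    by (intro sum.cong refl) (simp add: algebra_simps)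
  finally show ?thesis .
qed

section \<open>A convolution sum of the character modulo 3\<close>

lemma count_multiples_of_3: "(\<Sum>l\<in>{1..<d}. if 3 dvd int l then 1 else 0 :: int) = int ((d - 1) div 3)"
proof (induction d)
  case (Suc d)
  show ?case
  proof (cases "d = 0")
    case False
    hence "{1..<Suc d} = insert d {1..<d}" by auto
    moreover have "(if 3 dvd int d then 1 else 0) + int ((d - 1) div 3) = int (d div 3)"
      using False by (cases d) (auto, presburger+)
    ultimately show ?thesis using Suc.IH by simp
  qed simp
qed simp

lemma sum_multiples_of_3:
  fixes f :: "nat \<Rightarrow> int"
  assumes "n > 0"
  shows "(\<Sum>d | d dvd n. if 3 dvd d then f d else 0) = (\<Sum>e | 3 * e dvd n. f (3 * e))"
proof -
  have "(\<Sum>d | d dvd n. if 3 dvd d then f d else 0) = (\<Sum>d | d dvd n \<and> 3 dvd d. f d)"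
    using assms by (subst sum.inter_filter[symmetric]) auto
  also have "\<dots> = (\<Sum>e | 3 * e dvd n. f (3 * e))"
    by (rule sum.reindex_bij_witness[of _ "\<lambda>e. 3*e" "\<lambda>d. d div 3"]) auto
  finally show ?thesis .
qed

lemma sum_multiples_of_3_flip:
  assumes "n > 0"
  shows "(\<Sum>d | d dvd n. if 3 dvd d then 3 * int (n div d) else 0) = (\<Sum>d | d dvd n. if 3 dvd d then int d else 0)"
proof (cases "3 dvd n")
  case True
  then obtain m where m: "n = 3*m" by (auto simp: dvd_def)
  hence "m > 0" using assms by simp
  have "{e. 3 * e dvd n} = {e. e dvd m}" using m by auto
  thus ?thesis unfolding sum_multiples_of_3[OF assms]
    using sum_divisors_flip[OF \<open>m > 0\<close>, of "\<lambda>e. 3 * int e"] m by simp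
next
  case False
  hence "{e. 3 * e dvd n} = {}" by (auto intro: dvd_mult_left)
  thus ?thesis unfolding sum_multiples_of_3[OF assms] by simp
qed

text \<open>
  Let \<open>f\<close> be the indicator of the multiples of 3. Then \<open>f(a - b) - f(a + b) = \<chi>(a) \<chi>(b)\<close>, so
  Liouville's identity evaluates the sum. In the resulting divisor sum the terms in \<open>n / d\<close> are
  replaced by terms in \<open>d\<close>, by exchanging \<open>d\<close> with \<open>n / d\<close>, and with \<open>3 n / d\<close> on the multiples
  of 3; what remains is compared divisor by divisor.
\<close>

lemma liouville_sum_chi3:
  assumes n: "n > 0"
  shows "3 * liouville_sum n (\<lambda>a x b y. True) (\<lambda>a x b y. chi3 a * chi3 b)
    = (\<Sum>d | d dvd n \<and> \<not> 3 dvd d. int d) - (\<Sum>d | d dvd n. chi3 d)"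
proof -
  define f :: "int \<Rightarrow> int" where "f k = (if 3 dvd k then 1 else 0)" for k
  have chi: "chi3 a * chi3 b = f (int a - int b) - f (int a + int b)" for a b
  proof -
    have "a mod 3 = 0 \<or> a mod 3 = 1 \<or> a mod 3 = 2" "b mod 3 = 0 \<or> b mod 3 = 1 \<or> b mod 3 = 2"
      by linarith+
    moreover have "f (int a - int b) = (if a mod 3 = b mod 3 then 1 else 0)"
      unfolding f_def by presburger
    moreover have "f (int a + int b) = (if (a mod 3 + b mod 3) mod 3 = 0 then 1 else 0)"
      unfolding f_def by presburger
    ultimately show ?thesis unfolding chi3_def by (elim disjE) simp_all
  qed
  let ?m = "\<lambda>d. if 3 dvd d then 1 else 0 :: int"
  have "liouville_sum n (\<lambda>a x b y. True) (\<lambda>a x b y. chi3 a * chi3 b)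
    = (\<Sum>d | d dvd n. of_nat (n div d - 1) * (f 0 + 2 * f (int d))
        - of_nat (d - 1) * f (int d) - 2 * (\<Sum>l\<in>{1..<d}. f (int l)))"
    unfolding chi by (rule liouville_identity[OF _ n]) (simp add: f_def)
  also have "\<dots> = (\<Sum>d | d dvd n. (int (n div d) - 1) * (1 + 2 * ?m d)
        - (int d - 1) * ?m d - 2 * int ((d - 1) div 3))"
  proof (intro sum.cong refl, goal_cases)
    case (1 d)
    hence "d > 0" "n div d > 0" using n by (auto elim!: dvdE)
    hence "int (n div d - 1) = int (n div d) - 1" "int (d - 1) = int d - 1" by linarith+
    thus ?case unfolding f_def using count_multiples_of_3[of d]
      by (simp add: int_dvd_int_iff[of 3 d, simplified])
  qed
  finally have "3 * liouville_sum n (\<lambda>a x b y. True) (\<lambda>a x b y. chi3 a * chi3 b)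
     = 3 * (\<Sum>d | d dvd n. int (n div d)) + 2 * (\<Sum>d | d dvd n. if 3 dvd d then 3 * int (n div d) else 0)
       + (\<Sum>d | d dvd n. - 3 - 6 * ?m d - 3 * (int d - 1) * ?m d - 6 * int ((d - 1) div 3))"
    by (auto simp: sum_distrib_left sum.distrib[symmetric] algebra_simps intro!: sum.cong)
  also have "\<dots> = (\<Sum>d | d dvd n. 3 * int d + 2 * (if 3 dvd d then int d else 0)
      - 3 - 6 * ?m d - 3 * (int d - 1) * ?m d - 6 * int ((d - 1) div 3))"
    unfolding sum_divisors_flip[OF n] sum_multiples_of_3_flip[OF n]
    by (auto simp: sum_distrib_left sum.distrib[symmetric] algebra_simps intro!: sum.cong)
  also have "\<dots> = (\<Sum>d | d dvd n. (if \<not> 3 dvd d then int d else 0) - chi3 d)"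
  proof (intro sum.cong refl, goal_cases)
    case (1 d)
    hence "d > 0" using n by (auto elim!: dvdE)
    define k where "k = d div 3"
    consider "d = 3*k" | "d = 3*k+1" | "d = 3*k+2" unfolding k_def by linarith
    thus ?case
    proof cases
      case 1
      moreover have "(3*k - 1) div 3 = k - 1" by presburger
      moreover have "k > 0" using 1 \<open>d > 0\<close> by simp
      ultimately show ?thesis by (simp add: chi3_def of_nat_diff)
    next
      case 2
      hence "\<not> 3 dvd d" "(d - 1) div 3 = k" "d mod 3 = 1" by presburger+
      thus ?thesis using 2 by (simp add: chi3_def)
    next
      case 3
      hence "\<not> 3 dvd d" "(d - 1) div 3 = k" "d mod 3 = 2" by presburger+
      thus ?thesis using 3 by (simp add: chi3_def)
    qed
  qed
  also have "\<dots> = (\<Sum>d | d dvd n \<and> \<not> 3 dvd d. int d) - (\<Sum>d | d dvd n. chi3 d)"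
    using n by (subst sum_subtractf, subst sum.inter_filter[symmetric]) auto
  finally show ?thesis .
qed

section \<open>Representations by the quaternary form\<close>

lemma finite_linear_eq:
  assumes "c > 0" "d > 0"
  shows "finite {(i, j). c * i + d * j = (n::nat)}"
proof (rule finite_subset)
  have "i \<le> n \<and> j \<le> n" if "c * i + d * j = n" for i j
  proof -
    have "i \<le> c * i" "j \<le> d * j" using assms by auto
    thus ?thesis using that by linarith
  qed
  thus "{(i, j). c * i + d * j = n} \<subseteq> {..n} \<times> {..n}" by auto
qed simp

text \<open>
  The coefficient form of multiplying two generating functions, the first dilated by \<open>c\<close>
  and the second by \<open>d\<close>.
\<close>

lemma card_convolution:
  fixes f :: "'a \<Rightarrow> nat" and g :: "'b \<Rightarrow> nat"
  assumes "\<And>i. finite {u. f u = i}" "\<And>j. finite {v. g v = j}" "c > 0" "d > 0"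
  shows "card {(u, v). c * f u + d * g v = n}
    = (\<Sum>(i, j) | c * i + d * j = n. card {u. f u = i} * card {v. g v = j})"
proof -
  have "{(u, v). c * f u + d * g v = n}
    = (\<Union>(i, j)\<in>{(i, j). c * i + d * j = n}. {u. f u = i} \<times> {v. g v = j})" by auto
  also have "card \<dots> = (\<Sum>p\<in>{(i, j). c * i + d * j = n}.
      card (case p of (i, j) \<Rightarrow> {u. f u = i} \<times> {v. g v = j}))"
    by (rule card_UN_disjoint) (use assms finite_linear_eq in \<open>auto\<close>)
  also have "\<dots> = (\<Sum>(i, j) | c * i + d * j = n. card {u. f u = i} * card {v. g v = j})"
    by (intro sum.cong) (auto simp: card_cartesian_product)
  finally show ?thesis .
qed

text \<open>
  The norm as a natural number, as counting by convolution needs.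
\<close>

definition binary_norm :: "int \<times> int \<Rightarrow> nat" where
  "binary_norm = (\<lambda>(x, y). nat (eis_norm x y))"

definition quaternary_norm :: "(int \<times> int) \<times> (int \<times> int) \<Rightarrow> nat" where
  "quaternary_norm = (\<lambda>(u, v). binary_norm u + binary_norm v)"

lemma binary_norm_fibre: "{u. binary_norm u = n} = of_norm (int n)"
  using eis_norm_nonneg by (auto simp: binary_norm_def of_norm_def eq_nat_nat_iff nat_eq_iff)

lemma card_quaternary_norm_convolution:
  "card {u. quaternary_norm u = n}
    = (\<Sum>(i, j) | i + j = n. card (of_norm (int i)) * card (of_norm (int j)))"
  using card_convolution[of binary_norm binary_norm 1 1 n] finite_of_norm
  by (simp add: quaternary_norm_def binary_norm_fibre case_prod_unfold)

lemma finite_quaternary_norm_fibre: "finite {u. quaternary_norm u = n}"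
proof (rule finite_subset)
  show "{u. quaternary_norm u = n} \<subseteq> (\<Union>i\<le>n. {u. binary_norm u = i}) \<times> (\<Union>i\<le>n. {u. binary_norm u = i})"
    by (auto simp: quaternary_norm_def)
  show "finite ((\<Union>i\<le>n. {u. binary_norm u = i}) \<times> (\<Union>i\<le>n. {u. binary_norm u = i}))"
    by (auto simp: binary_norm_fibre finite_of_norm)
qed

lemma card_of_norm_0: "card (of_norm 0) = 1"
proof -
  have "of_norm 0 = {(0, 0)}" by (auto simp: of_norm_def eis_norm_eq_0_iff)
  thus ?thesis by simp
qed

text \<open>
  Writing \<open>i = a x\<close> and \<open>j = b y\<close> turns the pairs of divisors into the index set of a Liouville sum.
\<close>

lemma sum_chi3_convolution:
  "(\<Sum>(i, j) | 0 < i \<and> 0 < j \<and> i + j = n. (\<Sum>a | a dvd i. chi3 a) * (\<Sum>b | b dvd j. chi3 b))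
    = liouville_sum n (\<lambda>a x b y. True) (\<lambda>a x b y. chi3 a * chi3 b)"
proof -
  let ?I = "{(i, j). 0 < i \<and> 0 < j \<and> i + j = n}"
  let ?D = "\<lambda>(i, j). {a. a dvd i} \<times> {b. b dvd j}"
  have fin: "finite ?I"
    by (rule finite_subset[OF _ finite_linear_eq[of 1 1 n]]) auto
  have "(\<Sum>(i, j) | 0 < i \<and> 0 < j \<and> i + j = n. (\<Sum>a | a dvd i. chi3 a) * (\<Sum>b | b dvd j. chi3 b))
     = (\<Sum>p\<in>?I. \<Sum>(a, b)\<in>?D p. chi3 a * chi3 b)"
    by (intro sum.cong refl)
       (simp only: split_paired_all case_prod_conv sum_product sum.cartesian_product)
  also have "\<dots> = (\<Sum>(p, a, b)\<in>Sigma ?I ?D. chi3 a * chi3 b)"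
    by (rule sum.Sigma[OF fin]) auto
  also have "\<dots> = liouville_sum n (\<lambda>a x b y. True) (\<lambda>a x b y. chi3 a * chi3 b)"
    unfolding liouville_sum_def
    by (rule sum.reindex_bij_witness[of _ "\<lambda>(a, x, b, y). ((a*x, b*y), (a, b))"
          "\<lambda>((i, j), (a, b)). (a, i div a, b, j div b)"]) (auto elim!: dvdE)
  finally show ?thesis .
qed

text \<open>
  By Lorenz's theorem, the terms where one summand vanishes give \<open>12 \<Sum> \<chi>(d)\<close> and the others
  give \<open>36\<close> times the Liouville sum of \<open>\<chi>(a) \<chi>(b)\<close>; the sums of \<open>\<chi>\<close> cancel.
\<close>

theorem card_quaternary_norm_fibre:
  assumes n: "n > 0"
  shows "int (card {u. quaternary_norm u = n}) = 12 * (\<Sum>d | d dvd n \<and> \<not> 3 dvd d. int d)"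
proof -
  let ?L = "\<lambda>n. \<Sum>d | d dvd n. chi3 d"
  let ?r = "\<lambda>i. int (card (of_norm (int i)))"
  let ?I = "{(i, j). 0 < i \<and> 0 < j \<and> i + j = n}"
  have fin: "finite ?I"
    by (rule finite_subset[OF _ finite_linear_eq[of 1 1 n]]) auto
  have I: "{(i, j). i + j = n} = insert (0, n) (insert (n, 0) ?I)" using n by auto
  have "int (card {u. quaternary_norm u = n}) = (\<Sum>(i, j) | i + j = n. ?r i * ?r j)"
    by (simp add: card_quaternary_norm_convolution case_prod_unfold)
  also have "\<dots> = 2 * ?r n + (\<Sum>(i, j)\<in>?I. ?r i * ?r j)"
    unfolding I using n fin by (simp add: card_of_norm_0)
  also have "(\<Sum>(i, j)\<in>?I. ?r i * ?r j) = 36 * (\<Sum>(i, j)\<in>?I. ?L i * ?L j)"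
    by (subst sum_distrib_left) (intro sum.cong, auto simp: lorenz_theorem)
  also have "(\<Sum>(i, j)\<in>?I. ?L i * ?L j) = liouville_sum n (\<lambda>a x b y. True) (\<lambda>a x b y. chi3 a * chi3 b)"
    by (rule sum_chi3_convolution)
  finally show ?thesis using liouville_sum_chi3[OF n] lorenz_theorem[OF n] by simp
qed

section \<open>Reduction to divisor functions\<close>

lemma sigma_quotient:
  assumes "k > 0"
  shows "sigma (of_nat n / of_nat k) = (if k dvd n then sigma (of_nat (n div k)) else 0)"
proof (cases "k dvd n")
  case True
  then obtain m where "n = k*m" by (auto simp: dvd_def)
  thus ?thesis using assms by simp
next
  case False
  have "(of_nat n / of_nat k :: rat) \<notin> \<nat>"
  proof
    assume "(of_nat n / of_nat k :: rat) \<in> \<nat>"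
    then obtain m where "(of_nat n / of_nat k :: rat) = of_nat m" by (auto elim: Nats_cases)
    hence "(of_nat n :: rat) = of_nat (k * m)" using assms by (simp add: field_simps)
    hence "n = k * m" by (simp only: of_nat_eq_iff)
    thus False using False by simp
  qed
  thus ?thesis using False by (simp add: sigma_def)
qed

text \<open>
  The divisors that are multiples of 3 contribute \<open>3 \<sigma>(n / 3)\<close> to \<open>\<sigma>(n)\<close>. The form with
  \<open>n = 0\<close> included is the one that enters the convolution.
\<close>

lemma card_quaternary_norm_fibre_sigma:
  "int (card {u. quaternary_norm u = n}) = (if n = 0 then 1 else 0)
     + (12 * sigma (of_nat n) - 36 * sigma (of_nat n / 3))"
proof (cases "n = 0")
  case True
  have "{(i, j). i + j = (0::nat)} = {(0, 0)}" by auto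
  thus ?thesis using True by (simp add: card_quaternary_norm_convolution card_of_norm_0 sigma_0)
next
  case False
  hence n: "n > 0" by simp
  have "sigma (of_nat n) = (\<Sum>d | d dvd n. (if \<not> 3 dvd d then int d else 0) + (if 3 dvd d then int d else 0))"
    unfolding sigma_of_nat[OF n] by (intro sum.cong) auto
  also have "\<dots> = (\<Sum>d | d dvd n \<and> \<not> 3 dvd d. int d) + (\<Sum>d | d dvd n. if 3 dvd d then int d else 0)"
    unfolding sum.distrib using sum.inter_filter[of "{d. d dvd n}" int "\<lambda>d. \<not> 3 dvd d"] n by simp
  also have "(\<Sum>d | d dvd n. if 3 dvd d then int d else 0) = 3 * sigma (of_nat n / 3)"
  proof (cases "3 dvd n")
    case True
    then obtain m where m: "n = 3*m" by (auto simp: dvd_def)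
    hence "m > 0" using n by simp
    have div: "{e. 3 * e dvd n} = {e. e dvd m}" using m by auto
    have "sigma (of_nat n / 3) = (\<Sum>e | e dvd m. int e)" using m sigma_of_nat[OF \<open>m > 0\<close>] by simp
    thus ?thesis unfolding sum_multiples_of_3[OF n] div by (simp add: sum_distrib_left)
  next
    case False
    hence "{e. 3 * e dvd n} = {}" by (auto intro: dvd_mult_left)
    thus ?thesis using False sigma_quotient[of 3 n] by (simp add: sum_multiples_of_3[OF n])
  qed
  finally show ?thesis using card_quaternary_norm_fibre[OF n] False by simp
qed

section \<open>Convolution sums and the octonary form\<close>

lemma W_of_nat: "W r s (of_nat n) = (\<Sum>(l, m) | r * l + s * m = n. sigma (of_nat l) * sigma (of_nat m))"
  unfolding W_def of_nat_eq_iff ..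

text \<open>
  Only multiples of \<open>k\<close> and \<open>j\<close> contribute, since \<open>\<sigma>\<close> vanishes at fractions that are not integers.
\<close>

lemma W_dilate:
  assumes k: "k > 0" "j > 0" and rs: "r > 0" "s > 0"
  shows "(\<Sum>(l, m) | r * l + s * m = n. sigma (of_nat l / of_nat k) * sigma (of_nat m / of_nat j))
    = W (r * k) (s * j) (of_nat n)"
proof -
  have "(\<Sum>(l, m) | r * l + s * m = n. sigma (of_nat l / of_nat k) * sigma (of_nat m / of_nat j))
    = (\<Sum>(l, m) | r * l + s * m = n \<and> k dvd l \<and> j dvd m. sigma (of_nat l / of_nat k) * sigma (of_nat m / of_nat j))"
    by (rule sum.mono_neutral_right)
       (use finite_linear_eq[OF rs] k in \<open>auto simp: sigma_quotient split: if_splits\<close>)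
  also have "\<dots> = W (r * k) (s * j) (of_nat n)"
    unfolding W_of_nat
    by (rule sum.reindex_bij_witness[of _ "\<lambda>(l, m). (k * l, j * m)" "\<lambda>(l, m). (l div k, m div j)"])
       (use k in \<open>auto elim!: dvdE simp: mult.assoc\<close>)
  finally show ?thesis .
qed

lemma W_common_factor:
  assumes "k > 0"
  shows "W (k * r) (k * s) q = W r s (q / of_nat k)"
proof -
  have "of_nat (k * r * l + k * s * m) = q \<longleftrightarrow> of_nat (r * l + s * m) = q / of_nat k" for l m
    using assms by (auto simp: field_simps)
  thus ?thesis unfolding W_def by simp
qed

lemma R_eq_card: "R c d n = card {(u, v). c * quaternary_norm u + d * quaternary_norm v = n}"
proof -
  define h :: "int \<times> int \<times> int \<times> int \<times> int \<times> int \<times> int \<times> int \<Rightarrow> _"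
    where "h = (\<lambda>(x1, x2, x3, x4, x5, x6, x7, x8). (((x1, x2), (x3, x4)), ((x5, x6), (x7, x8))))"
  have q: "int (quaternary_norm ((x, y), (z, w))) = x^2 + x*y + y^2 + z^2 + z*w + w^2" for x y z w
    using eis_norm_nonneg[of x y] eis_norm_nonneg[of z w]
    by (simp add: quaternary_norm_def binary_norm_def) (simp add: eis_norm_def)
  have iff: "c * quaternary_norm u + d * quaternary_norm v = n
      \<longleftrightarrow> int n = int c * int (quaternary_norm u) + int d * int (quaternary_norm v)" for u v
    by (metis of_nat_add of_nat_eq_iff of_nat_mult)
  have "bij_betw h (reps c d n) {(u, v). c * quaternary_norm u + d * quaternary_norm v = n}"
    unfolding reps_def iff
    by (rule bij_betw_byWitness[where f' = "\<lambda>(((x1, x2), (x3, x4)), ((x5, x6), (x7, x8))).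
          (x1, x2, x3, x4, x5, x6, x7, x8)"]) (auto simp: h_def q add.assoc)
  thus ?thesis unfolding R_def by (rule bij_betw_same_card)
qed

theorem corollary7p1:
  fixes n :: nat
  assumes "n > 0"
  shows "int (R 1 11 n) =
      12 * sigma (of_nat n) - 36 * sigma (of_nat n / 3)
    + 12 * sigma (of_nat n / 11) - 36 * sigma (of_nat n / 33)
    + 144 * W 1 11 (of_nat n) + 1296 * W 1 11 (of_nat n / 3)
    - 432 * (W 3 11 (of_nat n) + W 1 33 (of_nat n))"
proof -
  let ?I = "{(l, m). 1 * l + 11 * m = n}"
  \<comment> \<open>\<open>e + A\<close> counts the representations by the quaternary form: \<open>A\<close> vanishes at 0, where the count is 1.\<close>
  define s t A where "s l = sigma (of_nat l)" and "t l = sigma (of_nat l / 3)"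
    and "A l = 12 * s l - 36 * t l" for l :: nat
  define e where "e l = (if l = 0 then 1 else 0 :: int)" for l :: nat
  have fin: "finite ?I" by (rule finite_linear_eq) auto
  have "int (R 1 11 n) = (\<Sum>(l, m)\<in>?I.
      int (card {u. quaternary_norm u = l}) * int (card {u. quaternary_norm u = m}))"
    using card_convolution[of quaternary_norm quaternary_norm 1 11 n] finite_quaternary_norm_fibre
    by (simp add: R_eq_card case_prod_unfold)
  also have "\<dots> = (\<Sum>(l, m)\<in>?I. (e l + A l) * (e m + A m))"
    unfolding card_quaternary_norm_fibre_sigma by (simp add: e_def A_def s_def t_def)
  also have "\<dots> = (\<Sum>(l, m)\<in>?I. A l * A m) + (\<Sum>(l, m)\<in>?I. e m * A l) + (\<Sum>(l, m)\<in>?I. e l * A m)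
      + (\<Sum>(l, m)\<in>?I. e l * e m)"
    unfolding sum.distrib[symmetric] by (intro sum.cong) (auto simp: algebra_simps)
  also have "(\<Sum>(l, m)\<in>?I. e l * e m) = 0"
    by (rule sum.neutral) (use assms in \<open>auto simp: e_def\<close>)
  also have "(\<Sum>(l, m)\<in>?I. e m * A l) = A n"
  proof -
    have "(\<Sum>(l, m)\<in>?I. e m * A l) = (\<Sum>(l, m)\<in>{(n, 0)}. e m * A l)"
      by (rule sum.mono_neutral_right[OF fin]) (auto simp: e_def split: if_splits)
    thus ?thesis by (simp add: e_def)
  qed
  also have "(\<Sum>(l, m)\<in>?I. e l * A m) = 12 * sigma (of_nat n / 11) - 36 * sigma (of_nat n / 33)"
  proof (cases "11 dvd n")
    case True
    then obtain k where k: "n = 11*k" by (auto simp: dvd_def)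
    have "(\<Sum>(l, m)\<in>?I. e l * A m) = (\<Sum>(l, m)\<in>{(0, k)}. e l * A m)"
      by (rule sum.mono_neutral_right[OF fin]) (auto simp: e_def k split: if_splits)
    thus ?thesis by (simp add: e_def A_def s_def t_def k)
  next
    case False
    hence "(\<Sum>(l, m)\<in>?I. e l * A m) = 0"
      by (intro sum.neutral) (auto simp: e_def)
    moreover have "\<not> 33 dvd n" using False by presburger
    ultimately show ?thesis using False sigma_quotient[of 11 n] sigma_quotient[of 33 n] by simp
  qed
  also have "(\<Sum>(l, m)\<in>?I. A l * A m) = 144 * (\<Sum>(l, m)\<in>?I. s l * s m)
      - 432 * (\<Sum>(l, m)\<in>?I. t l * s m) - 432 * (\<Sum>(l, m)\<in>?I. s l * t m)
      + 1296 * (\<Sum>(l, m)\<in>?I. t l * t m)"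
    unfolding sum_distrib_left sum.distrib[symmetric] sum_subtractf[symmetric]
    by (intro sum.cong) (auto simp: A_def algebra_simps)
  also have "(\<Sum>(l, m)\<in>?I. s l * s m) = W 1 11 (of_nat n)"
    by (simp add: W_of_nat s_def)
  also have "(\<Sum>(l, m)\<in>?I. t l * s m) = W 3 11 (of_nat n)"
    using W_dilate[of 3 1 1 11 n] by (simp add: s_def t_def)
  also have "(\<Sum>(l, m)\<in>?I. s l * t m) = W 1 33 (of_nat n)"
    using W_dilate[of 1 3 1 11 n] by (simp add: s_def t_def)
  also have "(\<Sum>(l, m)\<in>?I. t l * t m) = W 1 11 (of_nat n / 3)"
    using W_dilate[of 3 3 1 11 n] W_common_factor[of 3 1 11 "of_nat n"] by (simp add: t_def)
  finally show ?thesis by (simp add: A_def s_def t_def algebra_simps)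
qed

end
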